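(* Let $f:\mathbb{R}^n\to\mathbb{R}$ be twice continuously differentiable with $L$-Lipschitz gradient, and let $x^*$ be a strict saddle point of $f$. If $\{x_k\}_{k\ge 0}$ is generated by the BCGD method with constant step size $0<\alpha<\frac{1}{L}$ from an initial point $x_0$ distributed according to $\nu$, then $$\mathbb{P}_\nu\left[\lim_{k\to\infty} x_k = x^*\right]=0.$$
   Context: $f$ has Lipschitz continuous gradient with constant $L>0$: $\|\nabla f(x)-\nabla f(y)\|\le L\|x-y\|$ for all $x,y$. The variable is partitioned into $p$ blocks $x=(x(1),\dots,x(p))$ with $x(s)\in\mathbb{R}^{n_s}$, $\sum_s n_s=n$. Let $U_s\in\mathbb{R}^{n\times n_s}$ be the $s$-th block-column of $I_n$, so $(U_1,\dots,U_p)=I_n$, $x(s)=U_s^Tx$ and $\nabla_s f(x)=U_s^T\nabla f(x)$. BCGD method: given $x_k$, set $x_k^0=x_k$, $x_k^s=x_k^{s-1}-\alpha U_s\nabla_s f(x_k^{s-1})$ for $s=1,\dots,p$, and $x_{k+1}=x_k^p$. A point $x^*$ is a critical point if $\nabla f(x^* )=0$; it is a strict saddle if it is a critical point and $\lambda_{\min}(\nabla^2 f(x^* ))<0$. $\nu$ is a probability measure on $\mathbb{R}^n$ absolutely continuous with respect to Lebesgue measure, and $\mathbb{P}_\nu$ denotes probability with respect to it. *)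

theory Defs
  imports "HOL-Analysis.Analysis" "HOL-Probability.Probability"
begin

definition is_eigenvalue :: "real^'n^'n \<Rightarrow> real \<Rightarrow> bool" where
  "is_eigenvalue A lam \<longleftrightarrow> (\<exists>v. v \<noteq> 0 \<and> A *v v = lam *\<^sub>R v)"

definition lambda_min :: "real^'n^'n \<Rightarrow> real" where
  "lambda_min A = Min {lam. is_eigenvalue A lam}"

text \<open>Blocks are given by B 0, ..., B (p-1) (index sets of coordinates).
  block_sweep g B alpha s x is x_k^s for x = x_k, where g is the gradient.\<close>
fun block_sweep :: "(real^'n \<Rightarrow> real^'n) \<Rightarrow> (nat \<Rightarrow> 'n set) \<Rightarrow> real \<Rightarrow> nat \<Rightarrow> real^'n \<Rightarrow> real^'n" where
  "block_sweep g B alpha 0 x = x"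
| "block_sweep g B alpha (Suc s) x =
     (let y = block_sweep g B alpha s x
      in (\<chi> i. if i \<in> B s then y $ i - alpha * (g y $ i) else y $ i))"

definition bcgd :: "(real^'n \<Rightarrow> real^'n) \<Rightarrow> (nat \<Rightarrow> 'n set) \<Rightarrow> nat \<Rightarrow> real \<Rightarrow> real^'n \<Rightarrow> nat \<Rightarrow> real^'n" where
  "bcgd g B p alpha x0 k = (block_sweep g B alpha p ^^ k) x0"

definition block_partition :: "(nat \<Rightarrow> 'n set) \<Rightarrow> nat \<Rightarrow> bool" where
  "block_partition B p \<longleftrightarrow> p \<ge> 1 \<and> (\<forall>s<p. B s \<noteq> {}) \<and>
     (\<forall>s<p. \<forall>t<p. s \<noteq> t \<longrightarrow> B s \<inter> B t = {}) \<and> (\<Union>s<p. B s) = UNIV"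

end

theory Submission
  imports Defs
begin

text \<open>
  Let \<open>\<Phi>\<close> be one full sweep, \<open>D\<close> the Hessian at the saddle and \<open>A\<close> the sweep for the quadratic model
  \<open>d \<bullet> D d\<close>, which is the derivative of \<open>\<Phi>\<close> at the saddle. Neither the spectrum of \<open>A\<close> nor the
  centre-stable manifold theorem is needed. The linear sweep decreases \<open>d \<bullet> D d\<close> by an amount of order
  \<open>|D d|\<^sup>2\<close>, so for small \<open>c > 0\<close> the form \<open>P d = - d \<bullet> D d - c |d|\<^sup>2\<close> grows geometrically along \<open>A\<close> on
  the cone \<open>P \<ge> 0\<close>; this cone contains the eigenvectors \<open>v\<close> of the negative eigenvalue. Near the saddle
  the same holds for \<open>P (x - y)\<close> along pairs of orbits of \<open>\<Phi>\<close>. Hence two orbits that stay near the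
  saddle forever never differ initially by a nonzero multiple of \<open>v\<close>: the set of such starting points
  is disjoint from its translates along \<open>v\<close> and therefore null. Since \<open>|\<Phi> x - \<Phi> y|\<close> dominates
  \<open>(1 - \<alpha> L)\<^sup>p |x - y|\<close>, the inverse of \<open>\<Phi>\<close> is Lipschitz, so preimages of null sets under the iterates
  of \<open>\<Phi>\<close> are null, and countably many of them cover all starting points of convergent orbits.
\<close>

subsection \<open>Strict derivatives\<close>

text \<open>The two-point form of differentiability: both \<open>x\<close> and \<open>y\<close> vary
  near \<open>a\<close>. Two orbits of the sweep are compared later and neither needs to sit at the
  saddle, so an expansion around \<open>a\<close> alone would not suffice. Linearity of
  \<open>D\<close> is assumed separately wherever it is used.\<close>

definition has_strict_derivative_at ::
    "('a::real_normed_vector \<Rightarrow> 'b::real_normed_vector) \<Rightarrow> ('a \<Rightarrow> 'b) \<Rightarrow> 'a \<Rightarrow> bool" where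
  "has_strict_derivative_at g D a \<longleftrightarrow>
     (\<forall>e>0. \<exists>r>0. \<forall>x\<in>ball a r. \<forall>y\<in>ball a r.
        norm (g x - g y - D (x - y)) \<le> e * norm (x - y))"

text \<open>The map \<open>g z - H a *v z\<close> has derivative \<open>H z - H a\<close>, which is
  small near \<open>a\<close> by continuity of \<open>H\<close>; the mean value inequality on a ball
  then bounds its increments.\<close>

lemma C1_imp_has_strict_derivative_at:
  fixes g :: "real^'n \<Rightarrow> real^'m"
  assumes hess: "\<And>x. (g has_derivative (\<lambda>h. H x *v h)) (at x)"
    and cont: "continuous_on UNIV H"
  shows "has_strict_derivative_at g (\<lambda>h. H a *v h) a"
  unfolding has_strict_derivative_at_def
proof (intro allI impI)
  fix e :: real assume "e > 0"
  \<comment> \<open>The number of matrix entries: an entrywise bound \<open>e / C\<close> yields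
    operator norm at most \<open>e\<close>.\<close>
  define C where "C = real CARD('m) * real CARD('n)"
  have "C > 0" by (simp add: C_def)
  with \<open>e > 0\<close> have "e / C > 0" by simp
  moreover have "isCont H a" using cont by (simp add: continuous_on_eq_continuous_at)
  ultimately obtain r where r: "r > 0" and rH: "\<And>x. dist x a < r \<Longrightarrow> dist (H x) (H a) < e / C"
    unfolding continuous_at_eps_delta by blast
  have on: "onorm (\<lambda>h. H x *v h - H a *v h) \<le> e" if "x \<in> ball a r" for x
  proof -
    have "\<bar>(H x - H a) $ i $ j\<bar> \<le> e / C" for i j
    proof -
      have "\<bar>(H x - H a) $ i $ j\<bar> \<le> norm (H x - H a)"
        using component_le_norm_cart[of "(H x - H a) $ i" j] Finite_Cartesian_Product.norm_nth_le[where x = "H x - H a" and i = i] by linarith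
      also have "\<dots> \<le> e / C"
        using rH[of x] that by (simp add: dist_norm norm_minus_commute)
      finally show ?thesis .
    qed
    then have "onorm ((*v) (H x - H a)) \<le> C * (e / C)"
      unfolding C_def by (rule onorm_le_matrix_component)
    moreover have "(*v) (H x - H a) = (\<lambda>h. H x *v h - H a *v h)"
      by (simp add: fun_eq_iff matrix_vector_mult_diff_rdistrib)
    ultimately show ?thesis using \<open>C > 0\<close> by simp
  qed
  have "norm (g x - g y - H a *v (x - y)) \<le> e * norm (x - y)"
    if xy: "x \<in> ball a r" "y \<in> ball a r" for x y
  proof -
    have "norm ((\<lambda>z. g z - H a *v z) x - (\<lambda>z. g z - H a *v z) y) \<le> e * norm (x - y)"
    proof (rule differentiable_bound[OF convex_ball _ on xy])
      fix z assume "z \<in> ball a r"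
      show "((\<lambda>z. g z - H a *v z) has_derivative (\<lambda>h. H z *v h - H a *v h)) (at z within ball a r)"
        by (intro derivative_intros has_derivative_at_withinI[OF hess]
              bounded_linear_imp_has_derivative matrix_vector_mul_bounded_linear)
    qed
    then show ?thesis by (simp add: algebra_simps matrix_vector_mult_diff_distrib)
  qed
  with r show "\<exists>r>0. \<forall>x\<in>ball a r. \<forall>y\<in>ball a r.
      norm (g x - g y - H a *v (x - y)) \<le> e * norm (x - y)" by blast
qed

text \<open>The second difference is the increment over \<open>[0, t]\<close> of
  \<open>f (a + s u + t v) - f (a + s u)\<close> as a function of \<open>s\<close>. The mean value
  theorem turns it into a gradient difference over the displacement \<open>t v\<close>, which strict
  differentiability replaces by \<open>t D v\<close>.\<close>

lemma second_difference_bound: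
  fixes f :: "'a::euclidean_space \<Rightarrow> real"
  assumes grad: "\<And>x. (f has_derivative (\<lambda>h. g x \<bullet> h)) (at x)"
    and str: "\<And>x y. x \<in> ball a r \<Longrightarrow> y \<in> ball a r \<Longrightarrow> norm (g x - g y - D (x - y)) \<le> e * norm (x - y)"
    and lin: "linear D" and t: "0 < t" and small: "t * (norm u + norm v) < r"
  shows "\<bar>f (a + t *\<^sub>R u + t *\<^sub>R v) - f (a + t *\<^sub>R u) - f (a + t *\<^sub>R v) + f a - t\<^sup>2 * (D v \<bullet> u)\<bar>
           \<le> t\<^sup>2 * (e * norm v * norm u)"
proof -
  let ?\<phi> = "\<lambda>s. f (a + s *\<^sub>R u + t *\<^sub>R v) - f (a + s *\<^sub>R u)"
  let ?d = "\<lambda>s. g (a + s *\<^sub>R u + t *\<^sub>R v) - g (a + s *\<^sub>R u)"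
  have der: "(?\<phi> has_derivative (\<lambda>h. h * (?d s \<bullet> u))) (at s within {0..t})" for s
  proof -
    have 1: "((\<lambda>s. f (a + s *\<^sub>R u + w)) has_derivative (\<lambda>h. g (a + s *\<^sub>R u + w) \<bullet> (h *\<^sub>R u)))
            (at s within {0..t})" for w
    proof -
      have "((\<lambda>s. a + s *\<^sub>R u + w) has_derivative (\<lambda>h. h *\<^sub>R u)) (at s within {0..t})"
        by (auto intro!: derivative_eq_intros)
      from has_derivative_compose[OF this grad] show ?thesis by (simp add: o_def)
    qed
    from has_derivative_diff[OF 1[of "t *\<^sub>R v"] 1[of 0]] show ?thesis
      by (simp add: inner_diff_left algebra_simps)
  qed
  obtain s where s: "0 < s" "s < t" and mv: "?\<phi> t - ?\<phi> 0 = (t - 0) * (?d s \<bullet> u)"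
    using mvt_simple[of 0 t ?\<phi> "\<lambda>s h. h * (?d s \<bullet> u)"] t der by auto
  have su: "s * norm u \<le> t * norm u" using s by (simp add: mult_right_mono)
  have n1: "norm (s *\<^sub>R u + t *\<^sub>R v) < r"
  proof -
    have "norm (s *\<^sub>R u + t *\<^sub>R v) \<le> s * norm u + t * norm v"
      using norm_triangle_ineq[of "s *\<^sub>R u" "t *\<^sub>R v"] s t by simp
    then show ?thesis using su small by (simp add: distrib_left)
  qed
  have n2: "norm (s *\<^sub>R u) < r"
  proof -
    have "t * norm v \<ge> 0" using t by simp
    moreover have "norm (s *\<^sub>R u) = s * norm u" using s by simp
    ultimately show ?thesis using su small unfolding distrib_left by linarith
  qed
  \<comment> \<open>The two base points differ by exactly \<open>t v\<close>, and \<open>n1\<close>,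
    \<open>n2\<close> place both in the ball.\<close>
  have "norm (?d s - D (t *\<^sub>R v)) \<le> e * norm (t *\<^sub>R v)"
    using str[of "a + s *\<^sub>R u + t *\<^sub>R v" "a + s *\<^sub>R u"] n1 n2
    by (simp add: dist_norm add.assoc norm_minus_commute) (metis add.commute minus_add_distrib norm_minus_cancel uminus_add_conv_diff)
  then have "norm (?d s - t *\<^sub>R D v) \<le> e * (t * norm v)"
    using t by (simp add: linear_scale[OF lin])
  then have "\<bar>(?d s - t *\<^sub>R D v) \<bullet> u\<bar> \<le> e * (t * norm v) * norm u"
    by (meson Cauchy_Schwarz_ineq2 mult_right_mono norm_ge_zero order_trans)
  then have "t * \<bar>?d s \<bullet> u - t * (D v \<bullet> u)\<bar> \<le> t * (e * (t * norm v) * norm u)"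
    using t by (simp add: inner_diff_left)
  moreover have "t * \<bar>?d s \<bullet> u - t * (D v \<bullet> u)\<bar> = \<bar>t * (?d s \<bullet> u) - t\<^sup>2 * (D v \<bullet> u)\<bar>"
    using t abs_mult[of t "?d s \<bullet> u - t * (D v \<bullet> u)"]
    by (simp add: power2_eq_square right_diff_distrib mult.assoc)
  moreover have "t * (e * (t * norm v) * norm u) = t\<^sup>2 * (e * norm v * norm u)"
    by (simp add: power2_eq_square)
  moreover have "f (a + t *\<^sub>R u + t *\<^sub>R v) - f (a + t *\<^sub>R u) - f (a + t *\<^sub>R v) + f a = t * (?d s \<bullet> u)"
    using mv by simp
  ultimately show ?thesis by simp
qed

text \<open>The second difference is unchanged when \<open>u\<close> and \<open>v\<close> are
  exchanged, so both \<open>t^2 (D v \<bullet> u)\<close> and \<open>t^2 (D u \<bullet> v)\<close>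
  approximate the same number; dividing by \<open>t^2\<close> leaves an arbitrarily small
  error.\<close>

lemma strict_derivative_of_gradient_symmetric:
  fixes f :: "'a::euclidean_space \<Rightarrow> real"
  assumes grad: "\<And>x. (f has_derivative (\<lambda>h. g x \<bullet> h)) (at x)"
    and str: "has_strict_derivative_at g D a" and lin: "linear D"
  shows "D u \<bullet> v = u \<bullet> D v"
proof -
  define M where "M = 2 * (norm u * norm v)"
  have "\<bar>D u \<bullet> v - D v \<bullet> u\<bar> \<le> e" if "e > 0" for e
  proof -
    define e' where "e' = e / (M + 1)"
    have "M \<ge> 0" by (simp add: M_def)
    then have "e' > 0" using that by (simp add: e'_def)
    then obtain r where r: "r > 0" and st:
       "\<And>x y. x \<in> ball a r \<Longrightarrow> y \<in> ball a r \<Longrightarrow> norm (g x - g y - D (x - y)) \<le> e' * norm (x - y)"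
      using str unfolding has_strict_derivative_at_def by blast
    define t where "t = r / (norm u + norm v + 1)"
    have nn: "norm u + norm v + 1 > 0" by (smt (verit) norm_ge_zero)
    have t: "t > 0" using r nn by (simp add: t_def)
    have "t * (norm u + norm v + 1) = r" using nn by (simp add: t_def)
    then have sm: "t * (norm u + norm v) < r" using t by (simp add: algebra_simps)
    note a1 = second_difference_bound[where a = a and r = r, OF grad st lin t sm]
    have sm': "t * (norm v + norm u) < r" using sm by (simp add: add.commute)
    have swap: "a + t *\<^sub>R v + t *\<^sub>R u = a + t *\<^sub>R u + t *\<^sub>R v" by simp
    note a2 = second_difference_bound[where a = a and r = r, OF grad st lin t sm', unfolded swap]
    have "\<bar>t\<^sup>2 * (D u \<bullet> v) - t\<^sup>2 * (D v \<bullet> u)\<bar> \<le> t\<^sup>2 * (e' * norm v * norm u) + t\<^sup>2 * (e' * norm u * norm v)"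
      using a1 a2 by linarith
    also have "\<dots> = t\<^sup>2 * (e' * M)" by (simp add: M_def algebra_simps)
    finally have "t\<^sup>2 * \<bar>D u \<bullet> v - D v \<bullet> u\<bar> \<le> t\<^sup>2 * (e' * M)"
      by (simp add: abs_mult flip: right_diff_distrib)
    then have "\<bar>D u \<bullet> v - D v \<bullet> u\<bar> \<le> e' * M" using t by simp
    also have "\<dots> \<le> e" using \<open>M \<ge> 0\<close> that by (simp add: e'_def field_simps)
    finally show ?thesis .
  qed
  then have "D u \<bullet> v = D v \<bullet> u"
    using field_le_epsilon[of "\<bar>D u \<bullet> v - D v \<bullet> u\<bar>" 0] by simp
  then show ?thesis by (simp add: inner_commute)
qed

text \<open>A difference quotient of \<open>g\<close> at \<open>a\<close> in direction
  \<open>h\<close> has norm at most \<open>L |h|\<close> and approximates \<open>D h\<close> within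
  any prescribed error.\<close>

lemma strict_derivative_norm_le:
  assumes str: "has_strict_derivative_at g D a" and lin: "linear D"
    and lip: "\<And>x y. norm (g x - g y) \<le> L * norm (x - y)"
  shows "norm (D h) \<le> L * norm h"
proof (rule field_le_epsilon)
  fix \<epsilon> :: real assume \<epsilon>: "\<epsilon> > 0"
  define e where "e = \<epsilon> / (norm h + 1)"
  have h1: "norm h + 1 > 0" by (smt (verit) norm_ge_zero)
  then have e: "e > 0" "e * norm h \<le> \<epsilon>" using \<epsilon> by (auto simp: e_def field_simps)
  obtain r where r: "r > 0" and st: "\<And>x y. x \<in> ball a r \<Longrightarrow> y \<in> ball a r \<Longrightarrow>
      norm (g x - g y - D (x - y)) \<le> e * norm (x - y)"
    using str e(1) unfolding has_strict_derivative_at_def by blast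
  define t where "t = r / (norm h + 1)"
  have t: "t > 0" using r h1 by (simp add: t_def)
  have "t * (norm h + 1) = r" using h1 by (simp add: t_def)
  then have "t * norm h < r" using t by (simp add: algebra_simps)
  then have "norm (g (a + t *\<^sub>R h) - g a - D (t *\<^sub>R h)) \<le> e * (t * norm h)"
    using st[of "a + t *\<^sub>R h" a] r t by (simp add: dist_norm)
  then have "norm (D (t *\<^sub>R h)) \<le> norm (g (a + t *\<^sub>R h) - g a) + e * (t * norm h)"
    using norm_triangle_sub[of "D (t *\<^sub>R h)" "g (a + t *\<^sub>R h) - g a"] by (simp add: norm_minus_commute)
  also have "\<dots> \<le> L * (t * norm h) + e * (t * norm h)"
    using lip[of "a + t *\<^sub>R h" a] t by simp
  finally have "t * norm (D h) \<le> t * (L * norm h + e * norm h)"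
    using t by (simp add: linear_scale[OF lin] algebra_simps)
  then have "norm (D h) \<le> L * norm h + e * norm h" using t by simp
  with e(2) show "norm (D h) \<le> L * norm h + \<epsilon>" by linarith
qed

text \<open>Chain rule. The error splits into that of \<open>G\<close> on the pair
  \<open>F x\<close>, \<open>F y\<close> and the image under \<open>D2\<close> of the error of
  \<open>F\<close>; each receives half of \<open>e\<close>.\<close>

lemma has_strict_derivative_at_compose:
  assumes F: "has_strict_derivative_at F D1 a" and G: "has_strict_derivative_at G D2 (F a)"
    and bl: "bounded_linear D1" "bounded_linear D2"
  shows "has_strict_derivative_at (\<lambda>x. G (F x)) (\<lambda>x. D2 (D1 x)) a"
  unfolding has_strict_derivative_at_def
proof (intro allI impI)
  fix e :: real assume e: "e > 0"
  obtain K1 where K1: "K1 > 0" "\<And>x. norm (D1 x) \<le> norm x * K1"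
    using bounded_linear.pos_bounded[OF bl(1)] by blast
  obtain K2 where K2: "K2 > 0" "\<And>x. norm (D2 x) \<le> norm x * K2"
    using bounded_linear.pos_bounded[OF bl(2)] by blast
  \<comment> \<open>The cap 1 makes \<open>F\<close> Lipschitz near \<open>a\<close> with constant
    \<open>K1 + 1\<close>; \<open>e2\<close> compensates this factor, and the other bound on
    \<open>e1\<close> compensates \<open>K2\<close>.\<close>
  define e1 where "e1 = min 1 (e / (2 * K2))"
  define e2 where "e2 = e / (2 * (K1 + 1))"
  have e1: "e1 > 0" "e1 \<le> 1" "e1 * K2 \<le> e / 2"
    using e K2(1) by (auto simp: e1_def min_def field_simps)
  have e2: "e2 > 0" "e2 * (K1 + 1) = e / 2" using e K1(1) by (auto simp: e2_def field_simps)
  obtain r1 where r1: "r1 > 0" and F1: "\<And>x y. x \<in> ball a r1 \<Longrightarrow> y \<in> ball a r1 \<Longrightarrow>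
      norm (F x - F y - D1 (x - y)) \<le> e1 * norm (x - y)"
    using F e1(1) unfolding has_strict_derivative_at_def by blast
  obtain r2 where r2: "r2 > 0" and G2: "\<And>x y. x \<in> ball (F a) r2 \<Longrightarrow> y \<in> ball (F a) r2 \<Longrightarrow>
      norm (G x - G y - D2 (x - y)) \<le> e2 * norm (x - y)"
    using G e2(1) unfolding has_strict_derivative_at_def by blast
  \<comment> \<open>The second bound ensures that \<open>F\<close> maps \<open>ball a r\<close> into
    \<open>ball (F a) r2\<close>.\<close>
  define r where "r = min r1 (r2 / (K1 + 1))"
  have r: "r > 0" "r \<le> r1" "r \<le> r2 / (K1 + 1)" using r1 r2 K1(1) by (auto simp: r_def)
  have r': "(K1 + 1) * r \<le> r2" using r(3) K1(1) by (simp add: field_simps)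
  have lipF: "norm (F x - F y) \<le> (K1 + 1) * norm (x - y)" if "x \<in> ball a r" "y \<in> ball a r" for x y
  proof -
    have "norm (F x - F y - D1 (x - y)) \<le> e1 * norm (x - y)"
      using that r by (intro F1) auto
    also have "\<dots> \<le> 1 * norm (x - y)" using e1 by (intro mult_right_mono) auto
    finally have "norm (F x - F y) \<le> norm (x - y) + norm (D1 (x - y))"
      using norm_triangle_sub[of "F x - F y" "D1 (x - y)"] by simp
    then show ?thesis using K1(2)[of "x - y"] by (simp add: algebra_simps)
  qed
  have Fball: "F x \<in> ball (F a) r2" if "x \<in> ball a r" for x
  proof -
    have "norm (F a - F x) \<le> (K1 + 1) * norm (a - x)" using that r by (intro lipF) auto
    also have "\<dots> < (K1 + 1) * r"
      using that K1(1) by (intro mult_strict_left_mono) (auto simp: dist_norm)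
    finally show ?thesis using r' by (simp add: dist_norm)
  qed
  have "norm (G (F x) - G (F y) - D2 (D1 (x - y))) \<le> e * norm (x - y)"
    if xy: "x \<in> ball a r" "y \<in> ball a r" for x y
  proof -
    have "norm (G (F x) - G (F y) - D2 (F x - F y)) \<le> e2 * norm (F x - F y)"
      using xy by (intro G2 Fball)
    also have "\<dots> \<le> e2 * ((K1 + 1) * norm (x - y))"
      using e2 xy by (intro mult_left_mono lipF) auto
    also have "\<dots> = e / 2 * norm (x - y)" by (simp only: e2(2) mult.assoc[symmetric])
    finally have 1: "norm (G (F x) - G (F y) - D2 (F x - F y)) \<le> e / 2 * norm (x - y)" .
    have "norm (D2 (F x - F y - D1 (x - y))) \<le> norm (F x - F y - D1 (x - y)) * K2"
      by (rule K2)
    also have "\<dots> \<le> e1 * norm (x - y) * K2"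
      using xy r K2(1) by (intro mult_right_mono F1) auto
    also have "\<dots> = e1 * K2 * norm (x - y)" by simp
    also have "\<dots> \<le> e / 2 * norm (x - y)" using e1 by (intro mult_right_mono) auto
    finally have 2: "norm (D2 (F x - F y) - D2 (D1 (x - y))) \<le> e / 2 * norm (x - y)"
      by (simp add: bounded_linear.linear[OF bl(2)] linear_diff)
    show ?thesis
      using norm_triangle_ineq[of "G (F x) - G (F y) - D2 (F x - F y)" "D2 (F x - F y) - D2 (D1 (x - y))"] 1 2
      by simp
  qed
  with r(1) show "\<exists>r>0. \<forall>x\<in>ball a r. \<forall>y\<in>ball a r.
      norm (G (F x) - G (F y) - D2 (D1 (x - y))) \<le> e * norm (x - y)" by blast
qed

subsection \<open>Symmetric matrices\<close>

text \<open>A minimiser \<open>v\<close> of the quadratic form on the unit sphere is an eigenvector: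
  a nonzero residual \<open>z = A v - m v\<close> would be a descent direction for the nonnegative
  form \<open>q\<close>, which vanishes at \<open>v\<close>.\<close>

lemma symmetric_matrix_eigenvalue_exists:
  fixes A :: "real^'n^'n"
  assumes sym: "\<And>u v. (A *v u) \<bullet> v = u \<bullet> (A *v v)"
  shows "\<exists>lam. is_eigenvalue A lam"
proof -
  have cont: "continuous_on (sphere 0 1) (\<lambda>v. v \<bullet> (A *v v))"
    by (intro continuous_intros)
  have "sphere (0::real^'n) 1 \<noteq> {}" by simp
  from continuous_attains_inf[OF compact_sphere this cont]
  obtain v where v: "norm v = 1"
    and mn: "\<And>w. norm w = 1 \<Longrightarrow> v \<bullet> (A *v v) \<le> w \<bullet> (A *v w)"
    unfolding Bex_def Ball_def mem_sphere_0 by blast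
  define m where "m = v \<bullet> (A *v v)"
  define q where "q = (\<lambda>w. w \<bullet> (A *v w) - m * (w \<bullet> w))"
  have q_nonneg: "q w \<ge> 0" for w
  proof (cases "w = 0")
    case False
    have "m \<le> (w /\<^sub>R norm w) \<bullet> (A *v (w /\<^sub>R norm w))"
      unfolding m_def using False by (intro mn) simp
    then have "m \<le> (w \<bullet> (A *v w)) / (norm w)\<^sup>2"
      by (simp add: matrix_vector_mult_scaleR power2_eq_square field_simps)
    then show ?thesis using False by (simp add: q_def field_simps power2_norm_eq_inner)
  qed (simp add: q_def)
  have qv: "q v = 0" using v by (simp add: q_def m_def norm_eq_1)
  define z where "z = A *v v - m *\<^sub>R v"
  have exp: "q (v + t *\<^sub>R z) = 2 * t * (z \<bullet> z) + t\<^sup>2 * q z" for t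
  proof -
    have "q (v + t *\<^sub>R z) = q v + 2 * t * (z \<bullet> (A *v v) - m * (z \<bullet> v)) + t\<^sup>2 * q z"
      using sym[of v z] by (simp add: q_def algebra_simps matrix_vector_mult_scaleR matrix_vector_right_distrib
        inner_commute power2_eq_square)
    moreover have "z \<bullet> (A *v v) - m * (z \<bullet> v) = z \<bullet> z"
      by (simp add: z_def inner_diff_right)
    ultimately show ?thesis by (simp add: qv)
  qed
  have "z \<bullet> z = 0"
  proof (rule ccontr)
    assume "z \<bullet> z \<noteq> 0"
    then have zz: "z \<bullet> z > 0" by simp
    \<comment> \<open>With this \<open>t\<close>, the factor
      \<open>2 (z \<bullet> z) + t q z\<close> equals \<open>z \<bullet> z - t > 0\<close>; the
      summand 1 keeps the denominator positive when \<open>q z = 0\<close>.\<close>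
    define t where "t = - (z \<bullet> z) / (q z + 1)"
    have "q z \<ge> 0" by (rule q_nonneg)
    then have "t < 0" and t1: "t * (q z + 1) = - (z \<bullet> z)"
      using zz by (auto simp: t_def)
    have "q (v + t *\<^sub>R z) = t * (2 * (z \<bullet> z) + t * q z)"
      by (simp add: exp algebra_simps power2_eq_square)
    moreover have "2 * (z \<bullet> z) + t * q z > 0"
      using t1 \<open>t < 0\<close> zz unfolding distrib_left by linarith
    ultimately have "q (v + t *\<^sub>R z) < 0" using \<open>t < 0\<close> by (simp add: mult_neg_pos)
    then show False using q_nonneg[of "v + t *\<^sub>R z"] by simp
  qed
  then have "A *v v = m *\<^sub>R v" by (simp add: z_def)
  moreover have "v \<noteq> 0" using v by auto
  ultimately show ?thesis unfolding is_eigenvalue_def by blast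
qed

text \<open>Eigenvectors for distinct eigenvalues are orthogonal, hence independent, so one choice
  per eigenvalue injects the spectrum into a finite set. Finiteness gives the \<open>Min\<close> in
  \<open>lambda_min\<close> its meaning.\<close>

lemma symmetric_matrix_eigenvalues_finite:
  fixes A :: "real^'n^'n"
  assumes sym: "\<And>u v. (A *v u) \<bullet> v = u \<bullet> (A *v v)"
  shows "finite {lam. is_eigenvalue A lam}"
proof -
  let ?E = "{lam. is_eigenvalue A lam}"
  define V where "V = (\<lambda>lam. SOME v. v \<noteq> 0 \<and> A *v v = lam *\<^sub>R v)"
  have V: "V lam \<noteq> 0 \<and> A *v V lam = lam *\<^sub>R V lam" if "lam \<in> ?E" for lam
    using that unfolding V_def is_eigenvalue_def mem_Collect_eq by (rule someI_ex)
  have orth: "V l \<bullet> V m = 0" if "l \<in> ?E" "m \<in> ?E" "l \<noteq> m" for l m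
    using sym[of "V l" "V m"] V[OF that(1)] V[OF that(2)] that(3) by simp
  have "inj_on V ?E"
    by (rule inj_onI) (metis V orth inner_eq_zero_iff)
  moreover have "independent (V ` ?E)"
  proof (rule pairwise_orthogonal_independent)
    show "pairwise orthogonal (V ` ?E)"
      unfolding pairwise_def orthogonal_def using orth by blast
    show "0 \<notin> V ` ?E" using V by force
  qed
  ultimately show ?thesis
    using independent_imp_finite finite_imageD by blast
qed

lemma lambda_min_is_eigenvalue:
  fixes A :: "real^'n^'n"
  assumes "\<And>u v. (A *v u) \<bullet> v = u \<bullet> (A *v v)"
  shows "is_eigenvalue A (lambda_min A)"
  using Min_in[of "{lam. is_eigenvalue A lam}"] symmetric_matrix_eigenvalue_exists[OF assms]
    symmetric_matrix_eigenvalues_finite[OF assms]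
  unfolding lambda_min_def by auto

text \<open>With \<open>G\<close> a linear right inverse of \<open>D\<close> on its range, symmetry
  gives \<open>v \<bullet> D v = D v \<bullet> G (D v)\<close>, which is quadratic in
  \<open>D v\<close> alone. This is a gradient inequality of Lojasiewicz type for the quadratic
  form; \<open>D\<close> may be singular.\<close>

lemma quadratic_form_le_norm_image_sq:
  fixes D :: "'a::euclidean_space \<Rightarrow> 'a"
  assumes lin: "linear D" and sym: "\<And>u v. D u \<bullet> v = u \<bullet> D v"
  obtains C where "C > 0" "\<And>v. \<bar>v \<bullet> D v\<bar> \<le> C * (norm (D v))\<^sup>2"
proof -
  obtain G where G: "linear G" "\<And>v. D (G (D v)) = D v"
    using linear_exists_right_inverse_on[OF lin subspace_UNIV] by auto
  obtain C where C: "C > 0" "\<And>w. norm (G w) \<le> C * norm w"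
    using linear_bounded_pos[OF G(1)] by blast
  have "\<bar>v \<bullet> D v\<bar> \<le> C * (norm (D v))\<^sup>2" for v
  proof -
    have "v \<bullet> D v = D v \<bullet> G (D v)" by (metis G(2) sym)
    also have "\<bar>\<dots>\<bar> \<le> norm (D v) * norm (G (D v))" by (rule Cauchy_Schwarz_ineq2)
    also have "\<dots> \<le> norm (D v) * (C * norm (D v))" by (intro mult_left_mono C) simp
    finally show ?thesis by (simp add: power2_eq_square algebra_simps)
  qed
  with C(1) that show ?thesis by blast
qed

subsection \<open>Block sweeps\<close>

text \<open>The orthogonal projection onto the coordinates in \<open>S\<close>, that is
  \<open>U U^T\<close> for the corresponding block-column \<open>U\<close> of the identity
  matrix.\<close>

definition coord_restrict :: "'n set \<Rightarrow> real^'n \<Rightarrow> real^'n" where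
  "coord_restrict S v = (\<chi> i. if i \<in> S then v $ i else 0)"

lemma linear_coord_restrict: "linear (coord_restrict S)"
  by (rule linearI) (auto simp: coord_restrict_def vec_eq_iff)

lemma inner_coord_restrict: "v \<bullet> coord_restrict S v = (norm (coord_restrict S v))\<^sup>2"
  unfolding power2_norm_eq_inner inner_vec_def
  by (rule sum.cong) (auto simp: coord_restrict_def)

lemma norm_coord_restrict_le: "norm (coord_restrict S v) \<le> norm v"
  by (rule norm_le_componentwise_cart) (simp add: coord_restrict_def)

lemma block_sweep_Suc_eq:
  "block_sweep g B \<alpha> (Suc s) x =
     block_sweep g B \<alpha> s x - \<alpha> *\<^sub>R coord_restrict (B s) (g (block_sweep g B \<alpha> s x))"
  by (simp add: Let_def vec_eq_iff coord_restrict_def)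

declare block_sweep.simps(2)[simp del]

lemma sum_coord_restrict_partition:
  assumes "block_partition B p"
  shows "(\<Sum>s<p. coord_restrict (B s) v) = v"
proof -
  have "(\<Sum>s<p. coord_restrict (B s) v) $ i = v $ i" for i
  proof -
    have "i \<in> (\<Union>s<p. B s)" using assms unfolding block_partition_def by auto
    then obtain t where t: "t < p" "i \<in> B t" by blast
    have "(\<Sum>s<p. coord_restrict (B s) v) $ i = (\<Sum>s<p. if s = t then v $ i else 0)"
      unfolding sum_component
    proof (rule sum.cong)
      fix s assume "s \<in> {..<p}"
      then have "s \<noteq> t \<Longrightarrow> i \<notin> B s" using assms t unfolding block_partition_def by blast
      then show "coord_restrict (B s) v $ i = (if s = t then v $ i else 0)"
        using t by (auto simp: coord_restrict_def)
    qed simp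
    then show ?thesis using t by simp
  qed
  then show ?thesis by (simp add: vec_eq_iff)
qed

text \<open>One block step changes the difference of two points by a vector of norm at most
  \<open>\<alpha> L\<close> times its own, so the reverse triangle inequality costs a factor
  \<open>1 - \<alpha> L\<close> per block.\<close>

lemma block_sweep_expansive:
  assumes lip: "\<And>x y. norm (g x - g y) \<le> L * norm (x - y)" and "0 \<le> \<alpha>" "\<alpha> * L \<le> 1"
  shows "(1 - \<alpha> * L) ^ s * norm (x - y) \<le> norm (block_sweep g B \<alpha> s x - block_sweep g B \<alpha> s y)"
proof (induction s)
  case (Suc s)
  let ?x = "block_sweep g B \<alpha> s x" and ?y = "block_sweep g B \<alpha> s y"
  let ?P = "coord_restrict (B s)"
  have "norm (\<alpha> *\<^sub>R ?P (g ?x - g ?y)) \<le> \<alpha> * norm (g ?x - g ?y)"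
    using assms by (simp add: mult_left_mono norm_coord_restrict_le)
  also have "\<dots> \<le> \<alpha> * (L * norm (?x - ?y))" using assms by (intro mult_left_mono lip)
  finally have "(1 - \<alpha> * L) * norm (?x - ?y) \<le> norm (?x - ?y) - norm (\<alpha> *\<^sub>R ?P (g ?x - g ?y))"
    by (simp add: algebra_simps)
  also have "\<dots> \<le> norm ((?x - ?y) - \<alpha> *\<^sub>R ?P (g ?x - g ?y))" by (rule norm_triangle_ineq2)
  also have "(?x - ?y) - \<alpha> *\<^sub>R ?P (g ?x - g ?y) = block_sweep g B \<alpha> (Suc s) x - block_sweep g B \<alpha> (Suc s) y"
    by (simp add: block_sweep_Suc_eq linear_diff[OF linear_coord_restrict] algebra_simps)
  finally have "(1 - \<alpha> * L) * norm (?x - ?y) \<le> norm (block_sweep g B \<alpha> (Suc s) x - block_sweep g B \<alpha> (Suc s) y)" .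
  moreover have "(1 - \<alpha> * L) ^ Suc s * norm (x - y) \<le> (1 - \<alpha> * L) * norm (?x - ?y)"
    using mult_left_mono[OF Suc.IH, of "1 - \<alpha> * L"] assms(3) by (simp add: mult.assoc)
  ultimately show ?case by linarith
qed simp

lemma continuous_on_block_sweep:
  assumes "continuous_on UNIV g"
  shows "continuous_on UNIV (block_sweep g B \<alpha> s)"
proof (induction s)
  case (Suc s)
  have "continuous_on UNIV (\<lambda>x. coord_restrict (B s) (g (block_sweep g B \<alpha> s x)))"
    by (intro linear_continuous_on_compose[OF _ linear_coord_restrict]
        continuous_on_compose2[OF assms Suc.IH]) auto
  with Suc.IH show ?case unfolding block_sweep_Suc_eq by (intro continuous_intros)
qed simp

lemma linear_block_sweep:
  assumes "linear D"
  shows "linear (block_sweep D B \<alpha> s)"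
proof (induction s)
  case 0
  have "block_sweep D B \<alpha> 0 = id" by (simp add: fun_eq_iff)
  then show ?case using linear_id by metis
next
  case (Suc s)
  have "linear (\<lambda>x. coord_restrict (B s) (D (block_sweep D B \<alpha> s x)))"
    using linear_compose[OF linear_compose[OF Suc.IH assms] linear_coord_restrict] by (simp add: o_def)
  with Suc.IH show ?case unfolding block_sweep_Suc_eq
    by (intro linear_compose_sub linear_compose_scale_right)
qed

lemma block_sweep_fixed_point:
  assumes "g a = 0"
  shows "block_sweep g B \<alpha> s a = a"
  using assms by (induction s) (simp_all add: block_sweep_Suc_eq linear_0[OF linear_coord_restrict])

text \<open>A critical point is fixed by every block step, so the chain rule applies at the same
  point \<open>a\<close> each time, and the derivatives compose to the sweep driven by
  \<open>D\<close>.\<close>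

lemma has_strict_derivative_at_block_sweep:
  assumes str: "has_strict_derivative_at g D a" and lin: "linear D" and "g a = 0"
  shows "has_strict_derivative_at (block_sweep g B \<alpha> s) (block_sweep D B \<alpha> s) a"
proof (induction s)
  case 0
  then show ?case by (auto simp: has_strict_derivative_at_def intro: exI[of _ 1])
next
  case (Suc s)
  let ?P = "coord_restrict (B s)"
  have step: "has_strict_derivative_at (\<lambda>y. y - \<alpha> *\<^sub>R ?P (g y)) (\<lambda>y. y - \<alpha> *\<^sub>R ?P (D y)) a"
    unfolding has_strict_derivative_at_def
  proof (intro allI impI)
    fix e :: real assume e: "e > 0"
    define e' where "e' = e / (\<bar>\<alpha>\<bar> + 1)"
    have e': "e' > 0" "\<bar>\<alpha>\<bar> * e' \<le> e" using e by (auto simp: e'_def field_simps)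
    obtain r where r: "r > 0" and st: "\<And>x y. x \<in> ball a r \<Longrightarrow> y \<in> ball a r \<Longrightarrow>
        norm (g x - g y - D (x - y)) \<le> e' * norm (x - y)"
      using str e'(1) unfolding has_strict_derivative_at_def by blast
    have "norm (x - \<alpha> *\<^sub>R ?P (g x) - (y - \<alpha> *\<^sub>R ?P (g y)) - ((x - y) - \<alpha> *\<^sub>R ?P (D (x - y)))) \<le> e * norm (x - y)"
      if "x \<in> ball a r" "y \<in> ball a r" for x y
    proof -
      have "x - \<alpha> *\<^sub>R ?P (g x) - (y - \<alpha> *\<^sub>R ?P (g y)) - ((x - y) - \<alpha> *\<^sub>R ?P (D (x - y)))
          = - (\<alpha> *\<^sub>R ?P (g x - g y - D (x - y)))"
        by (simp add: linear_diff[OF linear_coord_restrict] scaleR_diff_right)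
      then have "norm (x - \<alpha> *\<^sub>R ?P (g x) - (y - \<alpha> *\<^sub>R ?P (g y)) - ((x - y) - \<alpha> *\<^sub>R ?P (D (x - y))))
          = \<bar>\<alpha>\<bar> * norm (?P (g x - g y - D (x - y)))" by simp
      also have "\<dots> \<le> \<bar>\<alpha>\<bar> * norm (g x - g y - D (x - y))"
        by (intro mult_left_mono norm_coord_restrict_le) auto
      also have "\<dots> \<le> \<bar>\<alpha>\<bar> * (e' * norm (x - y))" by (intro mult_left_mono st that) auto
      also have "\<dots> \<le> e * norm (x - y)"
        using mult_right_mono[OF e'(2), of "norm (x - y)"] by (simp add: mult.assoc)
      finally show ?thesis .
    qed
    with r show "\<exists>r>0. \<forall>x\<in>ball a r. \<forall>y\<in>ball a r.
        norm (x - \<alpha> *\<^sub>R ?P (g x) - (y - \<alpha> *\<^sub>R ?P (g y)) - ((x - y) - \<alpha> *\<^sub>R ?P (D (x - y)))) \<le> e * norm (x - y)"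
      by blast
  qed
  have "linear (\<lambda>y. y - \<alpha> *\<^sub>R ?P (D y))"
    using linear_compose[OF lin linear_coord_restrict]
    by (intro linear_compose_sub linear_compose_scale_right) (auto simp: o_def linear_id[unfolded id_def])
  then have bl: "bounded_linear (\<lambda>y. y - \<alpha> *\<^sub>R ?P (D y))" "bounded_linear (block_sweep D B \<alpha> s)"
    using linear_block_sweep[OF lin] by (auto simp: linear_conv_bounded_linear[symmetric])
  have "has_strict_derivative_at (\<lambda>y. y - \<alpha> *\<^sub>R ?P (g y)) (\<lambda>y. y - \<alpha> *\<^sub>R ?P (D y)) (block_sweep g B \<alpha> s a)"
    using step block_sweep_fixed_point[of g a, OF \<open>g a = 0\<close>] by simp
  from has_strict_derivative_at_compose[OF Suc.IH this bl(2) bl(1)]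
  show ?case unfolding block_sweep_Suc_eq[abs_def] .
qed

text \<open>With \<open>w\<close> the projected \<open>D d\<close>, the form changes by
  \<open>- 2 \<alpha> |w|^2 + \<alpha>^2 (w \<bullet> D w)\<close>. Since
  \<open>w \<bullet> D w \<le> L |w|^2\<close> and \<open>\<alpha> L < 1\<close>, at least
  \<open>\<alpha> |w|^2\<close> is lost.\<close>

lemma linear_block_step_descent:
  fixes D :: "real^'n \<Rightarrow> real^'n"
  assumes lin: "linear D" and sym: "\<And>u v. D u \<bullet> v = u \<bullet> D v"
    and bound: "\<And>v. norm (D v) \<le> L * norm v" and \<alpha>: "0 < \<alpha>" "\<alpha> * L < 1"
    and d': "d' = d - \<alpha> *\<^sub>R coord_restrict S (D d)"
  shows "d' \<bullet> D d' \<le> d \<bullet> D d - (norm (d' - d))\<^sup>2 / \<alpha>"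
proof -
  let ?w = "coord_restrict S (D d)"
  have "?w \<bullet> D ?w \<le> norm ?w * norm (D ?w)" by (rule norm_cauchy_schwarz)
  also have "\<dots> \<le> norm ?w * (L * norm ?w)" by (intro mult_left_mono bound) auto
  also have "\<dots> = L * (norm ?w)\<^sup>2" by (simp add: power2_eq_square)
  finally have "\<alpha>\<^sup>2 * (?w \<bullet> D ?w) \<le> \<alpha>\<^sup>2 * (L * (norm ?w)\<^sup>2)" by (intro mult_left_mono) auto
  also have "\<dots> = (\<alpha> * L) * (\<alpha> * (norm ?w)\<^sup>2)" by (simp add: power2_eq_square)
  also have "\<dots> \<le> 1 * (\<alpha> * (norm ?w)\<^sup>2)" using \<alpha> by (intro mult_right_mono) auto
  finally have 1: "\<alpha>\<^sup>2 * (?w \<bullet> D ?w) \<le> \<alpha> * (norm ?w)\<^sup>2" by simp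
  have "d' \<bullet> D d' = d \<bullet> D d - \<alpha> * (?w \<bullet> D d) - \<alpha> * (d \<bullet> D ?w) + \<alpha>\<^sup>2 * (?w \<bullet> D ?w)"
    by (simp add: d' linear_diff[OF lin] linear_scale[OF lin] inner_diff_left inner_diff_right
        power2_eq_square algebra_simps)
  also have "d \<bullet> D ?w = (norm ?w)\<^sup>2" by (metis sym inner_coord_restrict)
  also have "?w \<bullet> D d = (norm ?w)\<^sup>2" by (metis inner_commute inner_coord_restrict)
  finally have "d' \<bullet> D d' \<le> d \<bullet> D d - \<alpha> * (norm ?w)\<^sup>2" using 1 by linarith
  moreover have "(norm (d' - d))\<^sup>2 / \<alpha> = \<alpha> * (norm ?w)\<^sup>2"
    using \<alpha> by (simp add: d' power2_eq_square)
  ultimately show ?thesis by simp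
qed

text \<open>The witness \<open>\<delta>\<close> is the total length \<open>T p\<close> of the path
  through the block steps. It controls the displacement by the triangle inequality,
  \<open>D d\<close> block by block, and the decrease by Cauchy-Schwarz.\<close>

lemma linear_block_sweep_descent:
  fixes D :: "real^'n \<Rightarrow> real^'n"
  assumes lin: "linear D" and sym: "\<And>u v. D u \<bullet> v = u \<bullet> D v"
    and bound: "\<And>v. norm (D v) \<le> L * norm v" and \<alpha>: "0 < \<alpha>" "\<alpha> * L < 1"
    and part: "block_partition B p"
  shows "\<exists>\<delta>. norm (block_sweep D B \<alpha> p d - d) \<le> \<delta> \<and> \<alpha> / real p * norm (D d) \<le> \<delta> \<and>
    block_sweep D B \<alpha> p d \<bullet> D (block_sweep D B \<alpha> p d) \<le> d \<bullet> D d - \<delta>\<^sup>2 / (\<alpha> * real p)"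
proof -
  have p: "real p > 0" using part by (simp add: block_partition_def)
  let ?x = "\<lambda>s. block_sweep D B \<alpha> s d"
  define \<epsilon> where "\<epsilon> = (\<lambda>s. norm (?x (Suc s) - ?x s))"
  define T where "T = (\<lambda>s. \<Sum>t<s. \<epsilon> t)"
  have \<epsilon>0: "\<epsilon> s \<ge> 0" for s by (simp add: \<epsilon>_def)
  have Tmono: "T s \<le> T t" if "s \<le> t" for s t
    unfolding T_def using that by (intro sum_mono2) (auto simp: \<epsilon>0)
  have dist: "norm (?x s - d) \<le> T s" for s
  proof (induction s)
    case (Suc s)
    have "norm (?x (Suc s) - d) \<le> \<epsilon> s + norm (?x s - d)"
      unfolding \<epsilon>_def using norm_triangle_ineq[of "?x (Suc s) - ?x s" "?x s - d"] by simp
    then show ?case using Suc by (simp add: T_def)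
  qed (simp add: T_def)
  have desc: "?x s \<bullet> D (?x s) \<le> d \<bullet> D d - (\<Sum>t<s. (\<epsilon> t)\<^sup>2) / \<alpha>" for s
  proof (induction s)
    case (Suc s)
    then show ?case
      using linear_block_step_descent[OF lin sym bound \<alpha> block_sweep_Suc_eq, of B s d]
      by (simp add: \<epsilon>_def add_divide_distrib)
  qed simp
  \<comment> \<open>Block \<open>s\<close> of \<open>D\<close> at the current point
    \<open>?x s\<close> has norm \<open>\<epsilon> s / \<alpha>\<close>; passing back to
    \<open>d\<close> costs at most \<open>L * T s \<le> T s / \<alpha>\<close>. Together this is
    \<open>T (Suc s) / \<alpha>\<close>.\<close>
  have blk: "norm (coord_restrict (B s) (D d)) \<le> T p / \<alpha>" if "s < p" for s
  proof -
    let ?P = "coord_restrict (B s)"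
    have "\<epsilon> s = \<alpha> * norm (?P (D (?x s)))"
      using \<alpha> by (simp add: \<epsilon>_def block_sweep_Suc_eq)
    then have 1: "norm (?P (D (?x s))) = \<epsilon> s / \<alpha>" using \<alpha> by simp
    have "norm (?P (D (?x s - d))) \<le> norm (D (?x s - d))" by (rule norm_coord_restrict_le)
    also have "\<dots> \<le> L * norm (?x s - d)" by (rule bound)
    also have "\<dots> \<le> 1 / \<alpha> * norm (?x s - d)" using \<alpha> by (intro mult_right_mono) (auto simp: field_simps)
    also have "\<dots> \<le> 1 / \<alpha> * T s" using \<alpha> by (intro mult_left_mono dist) auto
    finally have 2: "norm (?P (D (?x s - d))) \<le> T s / \<alpha>" by simp
    have "?P (D d) = ?P (D (?x s)) - ?P (D (?x s - d))"
      by (simp add: linear_diff[OF lin] linear_diff[OF linear_coord_restrict])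
    then have "norm (?P (D d)) \<le> \<epsilon> s / \<alpha> + T s / \<alpha>"
      using norm_triangle_ineq4[of "?P (D (?x s))" "?P (D (?x s - d))"] 1 2 by simp
    also have "\<dots> = T (Suc s) / \<alpha>" by (simp add: T_def add_divide_distrib)
    also have "\<dots> \<le> T p / \<alpha>" using Tmono[of "Suc s" p] that \<alpha> by (simp add: divide_right_mono)
    finally show ?thesis .
  qed
  have "norm (D d) = norm (\<Sum>s<p. coord_restrict (B s) (D d))"
    by (simp add: sum_coord_restrict_partition[OF part])
  also have "\<dots> \<le> (\<Sum>s<p. T p / \<alpha>)" by (rule sum_norm_le) (use blk in auto)
  finally have "norm (D d) \<le> real p * T p / \<alpha>" by simp
  then have H: "\<alpha> / real p * norm (D d) \<le> T p" using \<alpha> p by (simp add: field_simps)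
  \<comment> \<open>Cauchy-Schwarz over the \<open>p\<close> steps converts the sum of squared step
    lengths into the squared total length.\<close>
  have "(T p)\<^sup>2 \<le> real p * (\<Sum>t<p. (\<epsilon> t)\<^sup>2)"
    unfolding T_def using sum_squared_le_sum_of_squares[of \<epsilon> "{..<p}"] by (simp add: mult.commute)
  then have "(T p)\<^sup>2 / (\<alpha> * real p) \<le> (\<Sum>t<p. (\<epsilon> t)\<^sup>2) / \<alpha>"
    using \<alpha> p by (simp add: field_simps)
  with desc[of p] dist[of p] H show ?thesis by (intro exI[of _ "T p"]) auto
qed

subsection \<open>Expanding cones\<close>

text \<open>The sublevel cone \<open>d \<bullet> D d \<le> - c |d|\<^sup>2\<close> is invariant for small \<open>c\<close>: inside it the step length
  \<open>\<delta>\<close> is at least of order \<open>\<surd>c |d|\<close>, so the gain \<open>b \<delta>\<^sup>2\<close> beats the loss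
  \<open>c (|A d|\<^sup>2 - |d|\<^sup>2) \<le> c (2 |d| \<delta> + \<delta>\<^sup>2)\<close>.\<close>
lemma descent_imp_expanding_cone:
  fixes D A :: "'a::euclidean_space \<Rightarrow> 'a"
  assumes lin: "linear D" and sym: "\<And>u v. D u \<bullet> v = u \<bullet> D v"
    and a: "a > 0" and b: "b > 0"
    and desc: "\<And>d. \<exists>\<delta>. norm (A d - d) \<le> \<delta> \<and> a * norm (D d) \<le> \<delta> \<and> A d \<bullet> D (A d) \<le> d \<bullet> D d - b * \<delta>\<^sup>2"
    and neg: "v \<bullet> D v < 0"
  obtains c m where "c > 0" "m > 0" "v \<bullet> (- D v - c *\<^sub>R v) > 0"
    "\<And>d. d \<bullet> (- D d - c *\<^sub>R d) \<ge> 0 \<Longrightarrow>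
       d \<bullet> (- D d - c *\<^sub>R d) + m * (norm d)\<^sup>2 \<le> A d \<bullet> (- D (A d) - c *\<^sub>R A d)"
proof -
  obtain G where G: "G > 0" "\<And>v. \<bar>v \<bullet> D v\<bar> \<le> G * (norm (D v))\<^sup>2"
    using quadratic_form_le_norm_image_sq[OF lin sym] by blast
  \<comment> \<open>Chosen so that \<open>|d \<bullet> D d|\<close> is at most
    \<open>(K \<delta>)^2\<close>.\<close>
  define K where "K = sqrt G / a"
  have K: "K > 0" using G(1) a by (simp add: K_def)
  have v: "v \<noteq> 0" using neg by auto
  \<comment> \<open>\<open>t\<close> is the square root of the later \<open>c\<close>. The bound 1
    gives \<open>c \<le> t\<close>, the second keeps the loss below half the gain
    \<open>b \<delta>^2\<close>, and the third puts \<open>v\<close> strictly inside the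
    cone.\<close>
  define t where "t = Min {1, b / (2 * (1 + 2 * K)), - (v \<bullet> D v) / (2 * (v \<bullet> v))}"
  have t: "t > 0" "t \<le> 1" "t \<le> b / (2 * (1 + 2 * K))" "t \<le> - (v \<bullet> D v) / (2 * (v \<bullet> v))"
    using b K neg v by (auto simp: t_def divide_neg_pos)
  have tK: "t * (1 + 2 * K) \<le> b / 2" using t(3) K by (simp add: field_simps)
  have tv: "t * (v \<bullet> v) < - (v \<bullet> D v)"
  proof -
    have "t * (v \<bullet> v) \<le> - (v \<bullet> D v) / 2" using t(4) v by (simp add: field_simps)
    then show ?thesis using neg by linarith
  qed
  define c where "c = t\<^sup>2"
  have c: "c > 0" "c \<le> t" using t by (auto simp: c_def power2_eq_square mult_left_le_one_le)
  \<comment> \<open>The other half of the gain, rewritten in terms of \<open>|d|\<close> through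
    \<open>t |d| \<le> K \<delta>\<close>.\<close>
  define m where "m = b / 2 * (t / K)\<^sup>2"
  have m: "m > 0" using b t K by (simp add: m_def)
  have cv: "v \<bullet> (- D v - c *\<^sub>R v) > 0"
    using tv mult_right_mono[OF c(2), of "v \<bullet> v"] by (simp add: inner_diff_right)
  have "d \<bullet> (- D d - c *\<^sub>R d) + m * (norm d)\<^sup>2 \<le> A d \<bullet> (- D (A d) - c *\<^sub>R A d)"
    if P: "d \<bullet> (- D d - c *\<^sub>R d) \<ge> 0" for d
  proof -
    obtain \<delta> where \<delta>: "norm (A d - d) \<le> \<delta>" "a * norm (D d) \<le> \<delta>"
        "A d \<bullet> D (A d) \<le> d \<bullet> D d - b * \<delta>\<^sup>2"
      using desc by blast
    have \<delta>0: "\<delta> \<ge> 0" using \<delta>(1) norm_ge_zero order_trans by blast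
    have "(t * norm d)\<^sup>2 \<le> \<bar>d \<bullet> D d\<bar>"
      using P by (simp add: inner_diff_right c_def power_mult_distrib power2_norm_eq_inner)
    also have "\<dots> \<le> (sqrt G * norm (D d))\<^sup>2" using G(1) G(2)[of d] by (simp add: power_mult_distrib)
    finally have "t * norm d \<le> sqrt G * norm (D d)"
      by (rule power2_le_imp_le) (use G(1) in simp)
    also have "\<dots> = K * (a * norm (D d))" using a by (simp add: K_def)
    also have "\<dots> \<le> K * \<delta>" using K \<delta>(2) by (intro mult_left_mono) auto
    finally have tK\<delta>: "t * norm d \<le> K * \<delta>" .
    then have "t / K * norm d \<le> \<delta>" using K by (simp add: field_simps)
    then have "(t / K * norm d)\<^sup>2 \<le> \<delta>\<^sup>2" using t K by (intro power_mono) auto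
    then have m\<delta>: "m * (norm d)\<^sup>2 \<le> b / 2 * \<delta>\<^sup>2"
      unfolding m_def power_mult_distrib mult.assoc using b by (intro mult_left_mono) auto
    have "norm (A d) \<le> norm d + \<delta>" using \<delta>(1) norm_triangle_sub[of "A d" d] by linarith
    then have "(norm (A d))\<^sup>2 \<le> (norm d + \<delta>)\<^sup>2" by (intro power_mono) auto
    then have "c * (norm (A d))\<^sup>2 \<le> c * (norm d + \<delta>)\<^sup>2" using c by (intro mult_left_mono) auto
    also have "\<dots> = c * (norm d)\<^sup>2 + (2 * t * (t * norm d) * \<delta> + c * \<delta>\<^sup>2)"
      by (simp add: c_def power2_eq_square algebra_simps)
    \<comment> \<open>The cross term is linear in \<open>|d|\<close>; the cone condition makes it
      quadratic in \<open>\<delta>\<close>.\<close>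
    also have "2 * t * (t * norm d) * \<delta> \<le> 2 * t * (K * \<delta>) * \<delta>"
      using t tK\<delta> \<delta>0 by (intro mult_right_mono mult_left_mono) auto
    also have "c * \<delta>\<^sup>2 \<le> t * \<delta>\<^sup>2" using c by (intro mult_right_mono) auto
    also have "c * (norm d)\<^sup>2 + (2 * t * (K * \<delta>) * \<delta> + t * \<delta>\<^sup>2) = c * (norm d)\<^sup>2 + t * (1 + 2 * K) * \<delta>\<^sup>2"
      by (simp add: power2_eq_square algebra_simps)
    also have "t * (1 + 2 * K) * \<delta>\<^sup>2 \<le> b / 2 * \<delta>\<^sup>2" using tK by (intro mult_right_mono) auto
    finally have "c * (norm (A d))\<^sup>2 \<le> c * (norm d)\<^sup>2 + b / 2 * \<delta>\<^sup>2" by simp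
    then show ?thesis using \<delta>(3) m\<delta> by (simp add: inner_diff_right power2_norm_eq_inner)
  qed
  with c(1) m cv that show ?thesis by blast
qed

text \<open>Strict differentiability transfers the cone estimate from \<open>A\<close> to
  differences of nearby orbits at the cost of half of \<open>m\<close>. A positive value of the form
  would then grow geometrically, although both orbits stay in one ball.\<close>

lemma expanding_cone_separates_bounded_orbits:
  fixes \<Phi> A T :: "'a::euclidean_space \<Rightarrow> 'a"
  assumes str: "has_strict_derivative_at \<Phi> A z" and A: "linear A" and T: "linear T"
    and m: "m > 0"
    and cone: "\<And>d. d \<bullet> T d \<ge> 0 \<Longrightarrow> d \<bullet> T d + m * (norm d)\<^sup>2 \<le> A d \<bullet> T (A d)"
  obtains r where "r > 0"
    "\<And>x y. (\<And>k. (\<Phi> ^^ k) x \<in> ball z r) \<Longrightarrow> (\<And>k. (\<Phi> ^^ k) y \<in> ball z r) \<Longrightarrow> (x - y) \<bullet> T (x - y) \<le> 0"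
proof -
  obtain K where K: "K > 0" "\<And>v. norm (A v) \<le> K * norm v"
    using linear_bounded_pos[OF A] by blast
  obtain C where C: "C > 0" "\<And>v. norm (T v) \<le> C * norm v"
    using linear_bounded_pos[OF T] by blast
  \<comment> \<open>The perturbation of the form is at most \<open>C e (2 K + 1) |d|^2\<close>,
    which this choice bounds by \<open>m / 2 * |d|^2\<close>; the cap 1 gives
    \<open>|\<Phi> x - \<Phi> y| \<le> (K + 1) |x - y|\<close>.\<close>
  define e where "e = min 1 (m / (2 * C * (2 * K + 1)))"
  have e: "e > 0" "e \<le> 1" "e \<le> m / (2 * C * (2 * K + 1))" using m C(1) K(1) by (auto simp: e_def)
  have "2 * C * (2 * K + 1) > 0" using C(1) K(1) by simp
  then have "e * (2 * C * (2 * K + 1)) \<le> m" using e(3) by (simp only: pos_le_divide_eq)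
  then have eC: "C * e * (2 * K + 1) \<le> m / 2" by (simp add: algebra_simps)
  obtain r where r: "r > 0" and st: "\<And>x y. x \<in> ball z r \<Longrightarrow> y \<in> ball z r \<Longrightarrow>
      norm (\<Phi> x - \<Phi> y - A (x - y)) \<le> e * norm (x - y)"
    using str e(1) unfolding has_strict_derivative_at_def by blast
  have T_le: "v \<bullet> T v \<le> C * (norm v)\<^sup>2" for v
  proof -
    have "v \<bullet> T v \<le> norm v * norm (T v)" by (rule norm_cauchy_schwarz)
    also have "\<dots> \<le> norm v * (C * norm v)" by (intro mult_left_mono C) auto
    finally show ?thesis by (simp add: power2_eq_square algebra_simps)
  qed
  have T_diff: "\<bar>u \<bullet> T u - v \<bullet> T v\<bar> \<le> C * norm (u - v) * (norm u + norm v)" for u v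
  proof -
    have "u \<bullet> T u - v \<bullet> T v = (u - v) \<bullet> T u + v \<bullet> T (u - v)"
      by (simp add: linear_diff[OF T] inner_diff_left inner_diff_right)
    also have "\<bar>\<dots>\<bar> \<le> norm (u - v) * norm (T u) + norm v * norm (T (u - v))"
      using Cauchy_Schwarz_ineq2[of "u - v" "T u"] Cauchy_Schwarz_ineq2[of v "T (u - v)"] by linarith
    also have "\<dots> \<le> norm (u - v) * (C * norm u) + norm v * (C * norm (u - v))"
      by (intro add_mono mult_left_mono C) auto
    finally show ?thesis by (simp add: algebra_simps)
  qed
  have grow: "(x - y) \<bullet> T (x - y) * (1 + m / (2 * C)) \<le> (\<Phi> x - \<Phi> y) \<bullet> T (\<Phi> x - \<Phi> y)"
    if xy: "x \<in> ball z r" "y \<in> ball z r" and pos: "(x - y) \<bullet> T (x - y) \<ge> 0" for x y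
  proof -
    let ?d = "x - y" and ?d' = "\<Phi> x - \<Phi> y"
    have n: "norm (?d' - A ?d) \<le> e * norm ?d" using st xy by simp
    moreover have "e * norm ?d \<le> norm ?d" using e by (simp add: mult_left_le_one_le)
    ultimately have "norm ?d' \<le> K * norm ?d + norm ?d"
      using norm_triangle_sub[of ?d' "A ?d"] K(2)[of ?d] by linarith
    then have n2: "norm ?d' + norm (A ?d) \<le> (2 * K + 1) * norm ?d"
      using K(2)[of ?d] by (simp add: algebra_simps)
    have "\<bar>?d' \<bullet> T ?d' - A ?d \<bullet> T (A ?d)\<bar> \<le> C * norm (?d' - A ?d) * (norm ?d' + norm (A ?d))"
      by (rule T_diff)
    also have "\<dots> \<le> C * (e * norm ?d) * ((2 * K + 1) * norm ?d)"
      using n n2 C(1) e(1) by (intro mult_mono mult_left_mono) auto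
    also have "\<dots> = C * e * (2 * K + 1) * (norm ?d)\<^sup>2" by (simp add: power2_eq_square)
    also have "\<dots> \<le> m / 2 * (norm ?d)\<^sup>2" using eC by (intro mult_right_mono) auto
    finally have "?d \<bullet> T ?d + m / 2 * (norm ?d)\<^sup>2 \<le> ?d' \<bullet> T ?d'"
      using cone[OF pos] by linarith
    \<comment> \<open>The additive gain in \<open>|d|^2\<close> dominates a multiple of the form
      itself, which yields a growth factor above 1.\<close>
    moreover have "m / (2 * C) * (?d \<bullet> T ?d) \<le> m / 2 * (norm ?d)\<^sup>2"
    proof -
      have "m / (2 * C) * (?d \<bullet> T ?d) \<le> m / (2 * C) * (C * (norm ?d)\<^sup>2)"
        using m C(1) by (intro mult_left_mono T_le) auto
      then show ?thesis using C(1) by simp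
    qed
    ultimately show ?thesis
      unfolding distrib_left mult_1_right mult.commute[of "?d \<bullet> T ?d" "m / (2 * C)"] by linarith
  qed
  have "(x - y) \<bullet> T (x - y) \<le> 0"
    if x: "\<And>k. (\<Phi> ^^ k) x \<in> ball z r" and y: "\<And>k. (\<Phi> ^^ k) y \<in> ball z r" for x y
  proof (rule ccontr)
    assume "\<not> ?thesis"
    then have pos: "(x - y) \<bullet> T (x - y) > 0" by simp
    define q where "q = (\<lambda>k. ((\<Phi> ^^ k) x - (\<Phi> ^^ k) y) \<bullet> T ((\<Phi> ^^ k) x - (\<Phi> ^^ k) y))"
    define \<rho> where "\<rho> = 1 + m / (2 * C)"
    have \<rho>: "\<rho> > 1" using m C(1) by (simp add: \<rho>_def)
    have q0: "q 0 > 0" using pos by (simp add: q_def)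
    have qk: "q 0 * \<rho> ^ k \<le> q k" for k
    proof (induction k)
      case (Suc k)
      have "0 \<le> q 0 * \<rho> ^ k" using q0 \<rho> by simp
      with Suc have "q k \<ge> 0" by linarith
      then have "q k * \<rho> \<le> q (Suc k)"
        unfolding q_def \<rho>_def using grow[OF x[of k] y[of k]] by simp
      moreover have "q 0 * \<rho> ^ k * \<rho> \<le> q k * \<rho>" using Suc \<rho> by (intro mult_right_mono) auto
      ultimately show ?case by (simp add: mult.commute mult.left_commute)
    qed simp
    have qb: "q k \<le> C * (2 * r)\<^sup>2" for k
    proof -
      have "norm ((\<Phi> ^^ k) x - (\<Phi> ^^ k) y) \<le> 2 * r"
        using x[of k] y[of k] dist_triangle2[of "(\<Phi> ^^ k) x" "(\<Phi> ^^ k) y" z]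
        by (simp add: dist_norm[symmetric] dist_commute)
      then have "C * (norm ((\<Phi> ^^ k) x - (\<Phi> ^^ k) y))\<^sup>2 \<le> C * (2 * r)\<^sup>2"
        using C(1) by (intro mult_left_mono power_mono) auto
      then show ?thesis unfolding q_def using T_le order_trans by blast
    qed
    obtain k where "C * (2 * r)\<^sup>2 / q 0 < \<rho> ^ k"
      using real_arch_pow[OF \<rho>] by blast
    then have "C * (2 * r)\<^sup>2 < q 0 * \<rho> ^ k" using q0 by (simp add: field_simps)
    with qk[of k] qb[of k] show False by linarith
  qed
  with r that show ?thesis by blast
qed

subsection \<open>Null sets\<close>

text \<open>Infinitely many of the disjoint translates \<open>W + v / (k + 1)\<close> lie in one bounded set.\<close>
lemma negligible_disjoint_translates:
  fixes W :: "'a::euclidean_space set"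
  assumes meas: "W \<in> sets lebesgue" and bdd: "bounded W"
    and disj: "\<And>x t. x \<in> W \<Longrightarrow> t \<noteq> 0 \<Longrightarrow> x + t *\<^sub>R v \<notin> W"
  shows "negligible W"
proof -
  have W: "W \<in> lmeasurable" using bounded_set_imp_lmeasurable[OF bdd meas] .
  obtain R where R: "\<And>x. x \<in> W \<Longrightarrow> norm x \<le> R" using bdd by (auto simp: bounded_iff)
  define F where "F = (\<lambda>k::nat. (+) ((1 / real (Suc k)) *\<^sub>R v) ` W)"
  have F: "F k \<in> lmeasurable" "measure lebesgue (F k) = measure lebesgue W" for k
    unfolding F_def by (rule measurable_translation[OF W], rule measure_translation)
  have pw: "pairwise (\<lambda>i j. disjnt (F i) (F j)) I" for I
  proof (rule pairwiseI)
    fix i j :: nat assume "i \<noteq> j"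
    have "x = y + (1 / real (Suc j) - 1 / real (Suc i)) *\<^sub>R v"
      if "(1 / real (Suc i)) *\<^sub>R v + x = (1 / real (Suc j)) *\<^sub>R v + y" for x y
      using that by (simp add: scaleR_diff_left algebra_simps)
    \<comment> \<open>A common point of two translates would give two points of \<open>W\<close>
      differing by this nonzero multiple of \<open>v\<close>.\<close>
    moreover have "1 / real (Suc j) - 1 / real (Suc i) \<noteq> 0" using \<open>i \<noteq> j\<close> by simp
    ultimately show "disjnt (F i) (F j)" using disj unfolding F_def disjnt_iff by blast
  qed
  have FR: "F k \<subseteq> cball 0 (R + norm v)" for k
  proof
    fix z assume "z \<in> F k"
    then obtain x where x: "x \<in> W" "z = (1 / real (Suc k)) *\<^sub>R v + x" by (auto simp: F_def)
    have "norm ((1 / real (Suc k)) *\<^sub>R v) \<le> 1 * norm v"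
      unfolding norm_scaleR by (intro mult_right_mono) auto
    then show "z \<in> cball 0 (R + norm v)"
      using R[OF x(1)] norm_triangle_ineq[of "(1 / real (Suc k)) *\<^sub>R v" x] x(2) by simp
  qed
  have bound: "real n * measure lebesgue W \<le> measure lebesgue (cball (0::'a) (R + norm v))" for n
  proof -
    have "real n * measure lebesgue W = measure lebesgue (\<Union>k<n. F k)"
      by (subst measure_UNION') (auto simp: F pw)
    also have "\<dots> \<le> measure lebesgue (cball (0::'a) (R + norm v))"
    proof (rule measure_mono_fmeasurable)
      show "(\<Union>k<n. F k) \<subseteq> cball 0 (R + norm v)" using FR by blast
      show "(\<Union>k<n. F k) \<in> sets lebesgue" by (intro sets.finite_UN) (auto intro: fmeasurableD F)
    qed simp
    finally show ?thesis .
  qed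
  have "measure lebesgue W = 0"
  proof (rule ccontr)
    assume "measure lebesgue W \<noteq> 0"
    then have "measure lebesgue W > 0" by (simp add: zero_less_measure_iff)
    from reals_Archimedean3[OF this] bound show False by (meson not_le)
  qed
  then show ?thesis using W by (simp add: negligible_iff_measure)
qed

text \<open>\<open>\<Phi>\<close> is injective and its inverse is Lipschitz with constant
  \<open>1 / c\<close> on the range, so the preimage is a Lipschitz image of a null set.\<close>

lemma negligible_vimage_expansive:
  fixes \<Phi> :: "'a::euclidean_space \<Rightarrow> 'a"
  assumes c: "c > 0" and exp: "\<And>x y. c * norm (x - y) \<le> norm (\<Phi> x - \<Phi> y)" and "negligible N"
  shows "negligible (\<Phi> -` N)"
proof -
  have inj: "inj \<Phi>"
  proof (rule injI)
    fix x y assume "\<Phi> x = \<Phi> y"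
    then have "c * norm (x - y) \<le> 0" using exp[of x y] by simp
    then show "x = y" using c by (simp add: mult_le_0_iff)
  qed
  have "negligible (inv \<Phi> ` (N \<inter> range \<Phi>))"
  proof (rule negligible_locally_Lipschitz_image[OF order_refl])
    show "negligible (N \<inter> range \<Phi>)" using assms(3) by (rule negligible_subset) auto
    fix x assume x: "x \<in> N \<inter> range \<Phi>"
    have "norm (inv \<Phi> y - inv \<Phi> x) \<le> 1 / c * norm (y - x)" if "y \<in> N \<inter> range \<Phi>" for y
      using exp[of "inv \<Phi> y" "inv \<Phi> x"] that x c by (simp add: f_inv_into_f field_simps)
    then show "\<exists>T B. open T \<and> x \<in> T \<and> (\<forall>y\<in>N \<inter> range \<Phi> \<inter> T. norm (inv \<Phi> y - inv \<Phi> x) \<le> B * norm (y - x))"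
      by (intro exI[of _ UNIV] exI[of _ "1 / c"]) auto
  qed
  moreover have "\<Phi> -` N = inv \<Phi> ` (N \<inter> range \<Phi>)"
  proof (intro equalityI subsetI)
    fix x assume "x \<in> \<Phi> -` N"
    then have "\<Phi> x \<in> N \<inter> range \<Phi>" by simp
    then have "inv \<Phi> (\<Phi> x) \<in> inv \<Phi> ` (N \<inter> range \<Phi>)" by (rule imageI)
    then show "x \<in> inv \<Phi> ` (N \<inter> range \<Phi>)" by (simp only: inv_f_f[OF inj])
  qed (auto simp: inv_f_f[OF inj])
  ultimately show ?thesis by simp
qed

section \<open>Starting points of convergent orbits\<close>

lemma continuous_on_funpow:
  fixes \<Phi> :: "'a::topological_space \<Rightarrow> 'a"
  assumes "continuous_on UNIV \<Phi>"
  shows "continuous_on UNIV (\<Phi> ^^ k)"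
proof (induction k)
  case (Suc k)
  have "continuous_on UNIV (\<lambda>x. \<Phi> ((\<Phi> ^^ k) x))"
    by (rule continuous_on_compose2[OF assms Suc]) auto
  then show ?case by (simp add: o_def)
qed (simp add: id_def)

lemma negligible_convergent_orbits:
  fixes \<Phi> A T :: "'a::euclidean_space \<Rightarrow> 'a"
  assumes str: "has_strict_derivative_at \<Phi> A z" and A: "linear A" and T: "linear T"
    and m: "m > 0"
    and cone: "\<And>d. d \<bullet> T d \<ge> 0 \<Longrightarrow> d \<bullet> T d + m * (norm d)\<^sup>2 \<le> A d \<bullet> T (A d)"
    and v: "v \<bullet> T v > 0"
    and c: "c > 0" and exp: "\<And>x y. c * norm (x - y) \<le> norm (\<Phi> x - \<Phi> y)"
    and cont: "continuous_on UNIV \<Phi>"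
  shows "negligible {x. (\<lambda>k. (\<Phi> ^^ k) x) \<longlonglongrightarrow> z}"
proof -
  obtain r where r: "r > 0" and sep:
    "\<And>x y. (\<And>k. (\<Phi> ^^ k) x \<in> ball z r) \<Longrightarrow> (\<And>k. (\<Phi> ^^ k) y \<in> ball z r) \<Longrightarrow> (x - y) \<bullet> T (x - y) \<le> 0"
    using expanding_cone_separates_bounded_orbits[OF str A T m cone] by blast
  \<comment> \<open>The points whose entire forward orbit stays in the ball where \<open>sep\<close>
    applies.\<close>
  define W where "W = (\<Inter>k. (\<Phi> ^^ k) -` ball z r)"
  have "negligible W"
  proof (rule negligible_disjoint_translates)
    have "(\<Phi> ^^ k) -` ball z r \<in> sets borel" for k
      using continuous_on_funpow[OF cont] by (intro borel_open open_vimage) auto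
    then have "W \<in> sets borel" unfolding W_def by (intro sets.countable_INT) auto
    then show "W \<in> sets lebesgue" by simp
    have "W \<subseteq> (\<Phi> ^^ 0) -` ball z r" unfolding W_def by blast
    then show "bounded W" by (simp add: bounded_subset[OF bounded_ball])
    fix x t assume x: "x \<in> W" and t: "t \<noteq> (0::real)"
    show "x + t *\<^sub>R v \<notin> W"
    proof
      assume "x + t *\<^sub>R v \<in> W"
      with x have "(x + t *\<^sub>R v - x) \<bullet> T (x + t *\<^sub>R v - x) \<le> 0"
        by (intro sep) (auto simp: W_def)
      then have "(t * t) * (v \<bullet> T v) \<le> 0" by (simp add: linear_scale[OF T] mult.assoc)
      moreover have "t * t > 0" using t by (metis not_real_square_gt_zero)
      ultimately show False using mult_pos_pos[OF _ v] by (meson not_le)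
    qed
  qed
  then have "negligible ((\<Phi> ^^ n) -` W)" for n
  proof (induction n)
    case (Suc n)
    \<comment> \<open>The first application of \<open>\<Phi>\<close> is split off, so that the
      inductive null set is pulled back by a single expansive map.\<close>
    have "(\<Phi> ^^ Suc n) -` W = \<Phi> -` ((\<Phi> ^^ n) -` W)"
      by (simp only: funpow_Suc_right vimage_comp)
    then show ?case using negligible_vimage_expansive[OF c exp Suc.IH[OF Suc.prems]] by (simp only:)
  qed simp
  then have "negligible (\<Union>n. (\<Phi> ^^ n) -` W)" by (intro negligible_countable_Union) auto
  moreover have "{x. (\<lambda>k. (\<Phi> ^^ k) x) \<longlonglongrightarrow> z} \<subseteq> (\<Union>n. (\<Phi> ^^ n) -` W)"
  proof
    fix x assume "x \<in> {x. (\<lambda>k. (\<Phi> ^^ k) x) \<longlonglongrightarrow> z}"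
    then obtain n where n: "\<And>k. k \<ge> n \<Longrightarrow> dist ((\<Phi> ^^ k) x) z < r"
      using r unfolding lim_sequentially by blast
    have "(\<Phi> ^^ n) x \<in> W" unfolding W_def
    proof (intro InterI, clarsimp)
      fix k show "dist z ((\<Phi> ^^ k) ((\<Phi> ^^ n) x)) < r"
        using n[of "k + n"] by (simp add: funpow_add dist_commute)
    qed
    then show "x \<in> (\<Union>n. (\<Phi> ^^ n) -` W)" by blast
  qed
  ultimately show ?thesis by (rule negligible_subset)
qed

text \<open>Convergence to \<open>z\<close> can be tested with the tolerances
  \<open>1 / (j + 1)\<close>, which leaves countable quantifiers over Borel conditions.\<close>

lemma sets_borel_convergent_orbits:
  fixes \<Phi> :: "'a::euclidean_space \<Rightarrow> 'a"
  assumes "continuous_on UNIV \<Phi>"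
  shows "{x. (\<lambda>k. (\<Phi> ^^ k) x) \<longlonglongrightarrow> z} \<in> sets borel"
proof -
  have [measurable]: "(\<Phi> ^^ k) \<in> borel_measurable borel" for k
    by (intro borel_measurable_continuous_onI continuous_on_funpow assms)
  have "{x. (\<lambda>k. (\<Phi> ^^ k) x) \<longlonglongrightarrow> z}
      = {x \<in> space borel. \<forall>j. \<exists>n. \<forall>k\<ge>n. dist ((\<Phi> ^^ k) x) z < 1 / real (Suc j)}"
    unfolding lim_sequentially
    by (auto simp del: of_nat_Suc) (meson nat_approx_posE order.strict_trans)
  also have "\<dots> \<in> sets borel" by measurable
  finally show ?thesis .
qed

section \<open>Null set of starting points for BCGD\<close>

theorem theorem2:
  fixes f :: "real^'n \<Rightarrow> real"
    and g :: "real^'n \<Rightarrow> real^'n"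
    and H :: "real^'n \<Rightarrow> real^'n^'n"
    and B :: "nat \<Rightarrow> 'n set"
    and p :: nat and L alpha :: real and xs :: "real^'n"
    and \<nu> :: "(real^'n) measure"
  assumes grad: "\<And>x. (f has_derivative (\<lambda>h. g x \<bullet> h)) (at x)"
    and hess: "\<And>x. (g has_derivative (\<lambda>h. H x *v h)) (at x)"
    and hess_cont: "continuous_on UNIV H"
    and L_pos: "L > 0"
    and lipschitz: "\<And>x y. norm (g x - g y) \<le> L * norm (x - y)"
    and blocks: "block_partition B p"
    and crit: "g xs = 0"
    and strict: "lambda_min (H xs) < 0"
    and step: "0 < alpha" "alpha < 1 / L"
    and prob: "prob_space \<nu>"
    and sets_nu: "sets \<nu> = sets borel"
    and ac: "absolutely_continuous lborel \<nu>"
  shows "{x0. (\<lambda>k. bcgd g B p alpha x0 k) \<longlonglongrightarrow> xs} \<in> sets \<nu>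
       \<and> measure \<nu> {x0. (\<lambda>k. bcgd g B p alpha x0 k) \<longlonglongrightarrow> xs} = 0"
proof -
  define D where "D = (\<lambda>h. H xs *v h)"
  define \<Phi> where "\<Phi> = block_sweep g B alpha p"
  define A where "A = block_sweep D B alpha p"
  have aL: "alpha * L < 1" using step L_pos by (simp add: field_simps)
  have p: "real p > 0" using blocks by (simp add: block_partition_def)
  have lin: "linear D" by (simp add: D_def matrix_vector_mul_linear)
  have str: "has_strict_derivative_at g D xs"
    unfolding D_def by (rule C1_imp_has_strict_derivative_at[OF hess hess_cont])
  have sym: "D u \<bullet> v = u \<bullet> D v" for u v
    by (rule strict_derivative_of_gradient_symmetric[OF grad str lin])
  have "is_eigenvalue (H xs) (lambda_min (H xs))"
    by (rule lambda_min_is_eigenvalue) (rule sym[unfolded D_def])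
  then obtain v where v: "v \<noteq> 0" "D v = lambda_min (H xs) *\<^sub>R v"
    unfolding is_eigenvalue_def D_def by blast
  have neg: "v \<bullet> D v < 0" using v strict by (simp add: mult_neg_pos)
  have bound: "norm (D h) \<le> L * norm h" for h
    by (rule strict_derivative_norm_le[OF str lin lipschitz])
  have A_lin: "linear A" unfolding A_def by (rule linear_block_sweep[OF lin])
  have \<Phi>_str: "has_strict_derivative_at \<Phi> A xs"
    unfolding \<Phi>_def A_def by (rule has_strict_derivative_at_block_sweep[where g = g, OF str lin crit])
  have cont: "continuous_on UNIV \<Phi>"
    unfolding \<Phi>_def
    by (intro continuous_on_block_sweep continuous_at_imp_continuous_on ballI has_derivative_continuous[OF hess])
  \<comment> \<open>Brings the sweep estimate into the form of the cone lemma, with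
    \<open>a = alpha / p\<close> and \<open>b = 1 / (alpha * p)\<close>.\<close>
  have desc: "\<exists>\<delta>. norm (A d - d) \<le> \<delta> \<and> alpha / real p * norm (D d) \<le> \<delta> \<and>
      A d \<bullet> D (A d) \<le> d \<bullet> D d - 1 / (alpha * real p) * \<delta>\<^sup>2" for d
    using linear_block_sweep_descent[OF lin sym bound step(1) aL blocks, of d] by (simp add: A_def)
  have pos: "alpha / real p > 0" "1 / (alpha * real p) > 0" using step p by auto
  obtain c m where cm: "c > 0" "m > 0" "v \<bullet> (- D v - c *\<^sub>R v) > 0"
    "\<And>d. d \<bullet> (- D d - c *\<^sub>R d) \<ge> 0 \<Longrightarrow>
       d \<bullet> (- D d - c *\<^sub>R d) + m * (norm d)\<^sup>2 \<le> A d \<bullet> (- D (A d) - c *\<^sub>R A d)"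
    using descent_imp_expanding_cone[OF lin sym pos desc neg] by blast
  have T_lin: "linear (\<lambda>d. - D d - c *\<^sub>R d)"
    using lin by (intro linear_compose_sub linear_compose_neg linear_scale_self)
  have exp: "(1 - alpha * L) ^ p * norm (x - y) \<le> norm (\<Phi> x - \<Phi> y)" for x y
    unfolding \<Phi>_def using step aL by (intro block_sweep_expansive lipschitz) auto
  define S where "S = {x. (\<lambda>k. (\<Phi> ^^ k) x) \<longlonglongrightarrow> xs}"
  have "negligible S" unfolding S_def
    by (rule negligible_convergent_orbits[OF \<Phi>_str A_lin T_lin cm(2) cm(4) cm(3) _ exp cont])
       (use aL in auto)
  moreover have S_borel: "S \<in> sets borel"
    unfolding S_def by (rule sets_borel_convergent_orbits[OF cont])
  \<comment> \<open>Negligibility refers to the completed Lebesgue measure; since \<open>S\<close>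
    is Borel it is also null for \<open>lborel\<close>, where absolute continuity applies.\<close>
  ultimately have "S \<in> null_sets lborel"
    by (simp add: negligible_iff_null_sets null_sets_completion_iff)
  then have "S \<in> null_sets \<nu>" using ac unfolding absolutely_continuous_def by blast
  then have "measure \<nu> S = 0" by (rule measure_eq_0_null_sets)
  moreover have "S = {x0. (\<lambda>k. bcgd g B p alpha x0 k) \<longlonglongrightarrow> xs}"
    by (simp add: S_def bcgd_def \<Phi>_def)
  ultimately show ?thesis using S_borel sets_nu by simp
qed

end
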